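(* There exists a family of complete rotational hyperbolic linear Weingarten surfaces in $\mathbb{R}^3$ that are non-embedded and periodic.
   Context: Let $H$ and $K$ denote the mean curvature (half the sum of the principal curvatures) and Gauss curvature of a surface immersed in $\mathbb{R}^3$. A hyperbolic linear Weingarten surface is an immersed surface satisfying $aH+bK=c$ for real constants $a,b,c$ with $a^2+4bc<0$. A rotational surface is one invariant under the group of rotations about a straight line (the axis); it is generated by rotating a profile (generating) curve in a plane containing the axis. The surface is called periodic if its generating curve is invariant under the discrete group generated by a nontrivial translation in the direction of the axis. Complete means complete for the induced Riemannian metric. Non-embedded means the surface has self-intersections. *)

theory Defs
  imports "HOL-Analysis.Analysis"
begin

text \<open>
  The abstract surface carrying a rotational surface that avoids its axis is the cylinder
  \<open>\<real> \<times> (\<real> / 2\<pi>\<int>)\<close>. A map from it to \<open>\<real>\<^sup>3\<close> is given by its lift \<open>X :: real \<times> real \<Rightarrow> real^3\<close>,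
  which is \<open>2\<pi>\<close>-periodic in the second variable; \<open>same_point\<close> is equality in the cylinder.
\<close>

definition same_point :: "real \<times> real \<Rightarrow> real \<times> real \<Rightarrow> bool" where
  "same_point q q' \<longleftrightarrow> fst q' = fst q \<and> (\<exists>k::int. snd q' = snd q + 2 * pi * of_int k)"

primrec Ck :: "nat \<Rightarrow> (real \<times> real \<Rightarrow> 'a::real_normed_vector) \<Rightarrow> bool" where
  "Ck 0 f \<longleftrightarrow> continuous_on UNIV f"
| "Ck (Suc k) f \<longleftrightarrow> (\<forall>q. f differentiable (at q)) \<and>
     (\<forall>v. Ck k (\<lambda>q. frechet_derivative f (at q) v))"

definition immersed_cylinder :: "(real \<times> real \<Rightarrow> real^3) \<Rightarrow> bool" where
  "immersed_cylinder X \<longleftrightarrow>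
     (\<forall>k. Ck k X) \<and>
     (\<forall>q q'. same_point q q' \<longrightarrow> X q = X q') \<and>
     (\<forall>q. inj (frechet_derivative X (at q)))"

subsection \<open>Curvatures\<close>

definition gauss_map :: "(real \<times> real \<Rightarrow> real^3) \<Rightarrow> real \<times> real \<Rightarrow> real^3" where
  "gauss_map X q =
     sgn (cross3 (frechet_derivative X (at q) (1, 0)) (frechet_derivative X (at q) (0, 1)))"

text \<open>
  The principal curvatures are the eigenvalues of the shape operator \<open>S\<close>, which is
  determined by \<open>dX (S v) = - dN v\<close>. For an immersion there are one (umbilic point) or two of
  them, so that \<open>Min\<close> and \<open>Max\<close> below list them with multiplicity.
\<close>

definition principal_curvatures :: "(real \<times> real \<Rightarrow> real^3) \<Rightarrow> real \<times> real \<Rightarrow> real set" where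
  "principal_curvatures X q =
     {\<kappa>. \<exists>v. v \<noteq> 0 \<and>
        - frechet_derivative (gauss_map X) (at q) v = \<kappa> *\<^sub>R frechet_derivative X (at q) v}"

definition mean_curvature :: "(real \<times> real \<Rightarrow> real^3) \<Rightarrow> real \<times> real \<Rightarrow> real" where
  "mean_curvature X q =
     (Min (principal_curvatures X q) + Max (principal_curvatures X q)) / 2"

definition gauss_curvature :: "(real \<times> real \<Rightarrow> real^3) \<Rightarrow> real \<times> real \<Rightarrow> real" where
  "gauss_curvature X q =
     Min (principal_curvatures X q) * Max (principal_curvatures X q)"

definition linear_weingarten ::
    "real \<Rightarrow> real \<Rightarrow> real \<Rightarrow> (real \<times> real \<Rightarrow> real^3) \<Rightarrow> bool" where
  "linear_weingarten a b c X \<longleftrightarrow>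
     (\<forall>q. a * mean_curvature X q + b * gauss_curvature X q = c)"

subsection \<open>The induced metric and completeness\<close>

definition first_form ::
    "(real \<times> real \<Rightarrow> real^3) \<Rightarrow> real \<times> real \<Rightarrow> real \<times> real \<Rightarrow> real \<times> real \<Rightarrow> real" where
  "first_form X q v w = frechet_derivative X (at q) v \<bullet> frechet_derivative X (at q) w"

definition path_speed ::
    "(real \<times> real \<Rightarrow> real^3) \<Rightarrow> (real \<Rightarrow> real \<times> real) \<Rightarrow> real \<Rightarrow> real" where
  "path_speed X c t =
     sqrt (first_form X (c t) (vector_derivative c (at t)) (vector_derivative c (at t)))"

text \<open>
  Paths in the cylinder are represented by their lifts. Integrability of the speed has to be
  required: \<open>valid_path\<close> allows the derivative to blow up at the exceptional points, and the
  integral of a non-integrable function is \<open>0\<close>.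
\<close>

definition induced_dist ::
    "(real \<times> real \<Rightarrow> real^3) \<Rightarrow> real \<times> real \<Rightarrow> real \<times> real \<Rightarrow> real" where
  "induced_dist X p q =
     Inf {integral {0..1} (path_speed X c) | c.
            valid_path c \<and> path_speed X c integrable_on {0..1} \<and>
            pathstart c = p \<and> same_point (pathfinish c) q}"

definition complete_cylinder :: "(real \<times> real \<Rightarrow> real^3) \<Rightarrow> bool" where
  "complete_cylinder X \<longleftrightarrow>
     (\<forall>\<sigma>::nat \<Rightarrow> real \<times> real.
        (\<forall>\<epsilon>>0. \<exists>N. \<forall>m\<ge>N. \<forall>n\<ge>N. induced_dist X (\<sigma> m) (\<sigma> n) < \<epsilon>) \<longrightarrow>
        (\<exists>p. (\<lambda>n. induced_dist X (\<sigma> n) p) \<longlonglongrightarrow> 0))"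

subsection \<open>Rotational surfaces\<close>

text \<open>Rotation by the angle \<open>\<phi>\<close> about the line through \<open>p\<close> with unit direction \<open>u\<close>
  (Rodrigues' formula).\<close>

definition rotate_about :: "real^3 \<Rightarrow> real^3 \<Rightarrow> real \<Rightarrow> real^3 \<Rightarrow> real^3" where
  "rotate_about p u \<phi> x =
     p + cos \<phi> *\<^sub>R (x - p) + sin \<phi> *\<^sub>R cross3 u (x - p) + ((1 - cos \<phi>) * (u \<bullet> (x - p))) *\<^sub>R u"

definition rotational_surface ::
    "(real \<times> real \<Rightarrow> real^3) \<Rightarrow> real^3 \<Rightarrow> real^3 \<Rightarrow> (real \<Rightarrow> real^3) \<Rightarrow> bool" where
  "rotational_surface X p u \<gamma> \<longleftrightarrow>
     norm u = 1 \<and>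
     (\<exists>v. v \<noteq> 0 \<and> u \<bullet> v = 0 \<and> (\<forall>s. \<gamma> s - p \<in> span {u, v})) \<and>
     (\<forall>s \<phi>. X (s, \<phi>) = rotate_about p u \<phi> (\<gamma> s))"

definition periodic_along :: "real^3 \<Rightarrow> (real \<Rightarrow> real^3) \<Rightarrow> bool" where
  "periodic_along u \<gamma> \<longleftrightarrow>
     (\<exists>T::real. T \<noteq> 0 \<and>
        (\<forall>k::int. (\<lambda>x. x + (of_int k * T) *\<^sub>R u) ` range \<gamma> = range \<gamma>))"

definition self_intersecting :: "(real \<times> real \<Rightarrow> real^3) \<Rightarrow> bool" where
  "self_intersecting X \<longleftrightarrow> (\<exists>q q'. \<not> same_point q q' \<and> X q = X q')"

definition congruent_sets :: "(real^3) set \<Rightarrow> (real^3) set \<Rightarrow> bool" where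
  "congruent_sets A B \<longleftrightarrow>
     (\<exists>f. (\<forall>x y. dist (f x) (f y) = dist x y) \<and> f ` A = B)"

end

theory Submission
  imports Defs
begin

text \<open>
  The surfaces are explicit. Let the profile curve have distance \<open>x\<close> from the axis and tangent
  angle \<open>\<theta>\<close>, and put \<open>y = sin \<theta>\<close>. The principal curvatures are \<open>d\<theta>/ds\<close>, where \<open>s\<close> is arc length, and
  \<open>y / x\<close>. Therefore \<open>2 x cos \<theta> H\<close>, \<open>2 x cos \<theta> K\<close> and \<open>2 x cos \<theta>\<close> are the derivatives along the curve of
  \<open>x y\<close>, \<open>y\<^sup>2\<close> and \<open>x\<^sup>2\<close>, and the relation \<open>a H + b K = c\<close> has the first integral
  \<open>a x y + b y\<^sup>2 - c x\<^sup>2\<close>. The hyperbolic condition says that this quadratic form is definite: its level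
  curves are ellipses. For \<open>a = -2\<close>, \<open>b = 2\<close>, \<open>c = -1\<close> they are \<open>(x - y)\<^sup>2 + y\<^sup>2 = \<rho>\<^sup>2 + 1\<close>.

  If \<open>\<rho> > 1\<close>, the arc \<open>x = y + sqrt (\<rho>\<^sup>2 + 1 - y\<^sup>2)\<close> of this ellipse over \<open>-1 \<le> y \<le> 1\<close> has \<open>x > 0\<close> and
  \<open>dx/dy > 0\<close>. Since \<open>dx/dy = ds/d\<theta>\<close>, the angle \<open>\<theta>\<close> may run over the whole real line as a regular
  parameter. Then \<open>x\<close> is \<open>2\<pi>\<close>-periodic in \<open>\<theta>\<close>, the height changes by a constant with each turn, and
  the tangent turns forever in one direction. That \<open>surf \<rho>\<close> satisfies the curvature relation is
  \<open>surf_linear_weingarten\<close>.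

  The induced metric \<open>(ds/d\<theta>)\<^sup>2 d\<theta>\<^sup>2 + x\<^sup>2 d\<phi>\<^sup>2\<close> has coefficients between two positive constants, so the
  surface is complete because the flat cylinder is (\<open>complete_if_comparable_to_flat\<close>). The constant
  change of the height is nonzero, which gives the period (\<open>surf_periodic\<close>). The profile curve is
  symmetric in the horizontal line through its point with \<open>\<theta> = \<pi>/2\<close>, and the intermediate
  value theorem shows that it crosses this line again (\<open>surf_self_intersecting\<close>). Finally \<open>\<rho>\<close> can be
  recovered from the set of points up to congruence, since the surface is periodic along its axis
  and its largest distance from the axis is \<open>\<rho> + 1\<close> (\<open>surf_congruent_imp_le\<close>). Values \<open>\<rho> = 2 + exp t\<close>
  therefore give a family indexed by the reals.
\<close>

section \<open>Completeness from a comparison with the flat cylinder\<close>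

lemma path_speed_eq:
  "path_speed X c t = norm (frechet_derivative X (at (c t)) (vector_derivative c (at t)))"
  by (simp add: path_speed_def first_form_def norm_eq_sqrt_inner)

lemma linepath_speed_integrable:
  assumes "\<And>v. continuous_on UNIV (\<lambda>q. frechet_derivative X (at q) v)"
  shows "path_speed X (linepath p q) integrable_on {0..1}"
proof -
  have "continuous_on {0..1} (\<lambda>t. frechet_derivative X (at (linepath p q t)) (q - p))"
    by (rule continuous_on_compose2[OF assms[of "q - p"]]) auto
  then have "continuous_on {0..1} (path_speed X (linepath p q))"
    unfolding path_speed_eq by (simp add: continuous_on_norm)
  then show ?thesis
    by (rule integrable_continuous_real)
qed

lemma induced_dist_le:
  assumes cont: "\<And>v. continuous_on UNIV (\<lambda>q. frechet_derivative X (at q) v)"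
    and upper: "\<And>q v. norm (frechet_derivative X (at q) v) \<le> M * norm v"
    and "same_point q' q"
  shows "induced_dist X p q \<le> M * dist p q'"
proof -
  let ?S = "{integral {0..1} (path_speed X c) | c.
            valid_path c \<and> path_speed X c integrable_on {0..1} \<and>
            pathstart c = p \<and> same_point (pathfinish c) q}"
  have int: "path_speed X (linepath p q') integrable_on {0..1}"
    using cont by (rule linepath_speed_integrable)
  have "bdd_below ?S"
    by (rule bdd_belowI[of _ 0]) (auto intro!: integral_nonneg simp: path_speed_eq)
  moreover have "integral {0..1} (path_speed X (linepath p q')) \<in> ?S"
    using int assms(3) by fastforce
  ultimately have "induced_dist X p q \<le> integral {0..1} (path_speed X (linepath p q'))"
    unfolding induced_dist_def by (rule cInf_lower[rotated])
  also have "\<dots> \<le> integral {0..1} (\<lambda>t::real. M * dist p q')"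
    by (rule integral_le[OF int])
      (simp_all add: path_speed_eq dist_norm norm_minus_commute[of p q'] upper integrable_const_ivl)
  finally show ?thesis by simp
qed

text \<open>
  Any invariant of the cylinder that is nonexpansive for the flat metric bounds the induced
  distance from below. Working with such a map \<open>e\<close> avoids the minimum over all lifts of the
  second endpoint, because a path may end at any of them without changing the value of \<open>e\<close>.
\<close>
lemma induced_dist_ge:
  fixes e :: "real \<times> real \<Rightarrow> 'a::metric_space"
  assumes cont: "\<And>v. continuous_on UNIV (\<lambda>q. frechet_derivative X (at q) v)"
    and lower: "\<And>q v. m * norm v \<le> norm (frechet_derivative X (at q) v)"
    and "m > 0"
    and nonexp: "\<And>p q. dist (e p) (e q) \<le> dist p q"
    and inv: "\<And>p q. same_point p q \<Longrightarrow> e p = e q"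
  shows "m * dist (e p) (e q) \<le> induced_dist X p q"
  unfolding induced_dist_def
proof (rule cInf_greatest)
  have "same_point q q"
    by (auto simp: same_point_def intro: exI[of _ 0])
  then show "{integral {0..1} (path_speed X c) | c.
            valid_path c \<and> path_speed X c integrable_on {0..1} \<and>
            pathstart c = p \<and> same_point (pathfinish c) q} \<noteq> {}"
    using linepath_speed_integrable[OF cont, of p q] by fastforce
next
  fix l
  assume "l \<in> {integral {0..1} (path_speed X c) | c.
            valid_path c \<and> path_speed X c integrable_on {0..1} \<and>
            pathstart c = p \<and> same_point (pathfinish c) q}"
  then obtain c where l: "l = integral {0..1} (path_speed X c)"
    and c: "valid_path c" "path_speed X c integrable_on {0..1}"
      "pathstart c = p" "same_point (pathfinish c) q"
    by auto
  obtain S where S: "finite S" "c C1_differentiable_on ({0..1} - S)"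
    and "continuous_on {0..1} c"
    using c(1) by (auto simp: valid_path_def piecewise_C1_differentiable_on_def)
  \<comment> \<open>The speed bounds the derivative at the exceptional points as well, whatever value
     \<open>vector_derivative\<close> takes there, so the norm of the integral is at most the length.\<close>
  have "((\<lambda>t. vector_derivative c (at t)) has_integral (c 1 - c 0)) {0..1}"
  proof (rule fundamental_theorem_of_calculus_interior_strong[OF \<open>finite S\<close>])
    fix t assume "t \<in> {0<..<1} - S"
    then have "c differentiable (at t)"
      using S(2) by (auto simp: C1_differentiable_on_eq)
    then show "(c has_vector_derivative vector_derivative c (at t)) (at t)"
      by (simp add: vector_derivative_works)
  qed (use \<open>continuous_on {0..1} c\<close> in auto)
  then have c': "((\<lambda>t. m *\<^sub>R vector_derivative c (at t)) has_integral m *\<^sub>R (c 1 - c 0)) {0..1}"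
    by (rule has_integral_cmul)
  have "norm (integral {0..1} (\<lambda>t. m *\<^sub>R vector_derivative c (at t))) \<le> l"
    unfolding l
    by (rule integral_norm_bound_integral)
      (use c' c(2) \<open>m > 0\<close> lower in \<open>auto simp: has_integral_integrable path_speed_eq\<close>)
  then have "m * dist (c 0) (c 1) \<le> l"
    using integral_unique[OF c'] \<open>m > 0\<close> by (simp add: dist_norm norm_minus_commute)
  moreover have "dist (e p) (e q) \<le> dist (c 0) (c 1)"
    using nonexp[of "c 0" "c 1"] c(3) inv[OF c(4)] by (simp add: pathstart_def pathfinish_def)
  then have "m * dist (e p) (e q) \<le> m * dist (c 0) (c 1)"
    using \<open>m > 0\<close> by simp
  ultimately show "m * dist (e p) (e q) \<le> l"
    by linarith
qed

lemma dist_cis_le: "dist (cis a) (cis b) \<le> dist a b"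
proof -
  have "cis a - cis b = cis b * (cis (a - b) - 1)"
    by (simp add: right_diff_distrib cis_mult)
  then have "dist (cis a) (cis b) = norm (exp (\<i> * of_real (a - b)) - 1)"
    by (simp only: dist_norm norm_mult norm_cis cis_conv_exp[symmetric] mult_1)
  also have "\<dots> = 2 * \<bar>sin ((a - b) / 2)\<bar>"
    by (rule dist_exp_i_1)
  also have "\<dots> \<le> dist a b"
    using abs_sin_x_le_abs_x[of "(a - b) / 2"] by (simp add: dist_real_def)
  finally show ?thesis .
qed

lemma Cauchy_comparison:
  assumes "m > 0" and "\<And>p q. m * dist (e p) (e q) \<le> D p q"
    and "\<forall>\<epsilon>>0. \<exists>N. \<forall>i\<ge>N. \<forall>j\<ge>N. D (\<sigma> i) (\<sigma> j) < \<epsilon>"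
  shows "Cauchy (\<lambda>n::nat. e (\<sigma> n))"
proof (rule metric_CauchyI)
  fix \<epsilon> :: real assume "\<epsilon> > 0"
  then obtain N where N: "\<forall>i\<ge>N. \<forall>j\<ge>N. D (\<sigma> i) (\<sigma> j) < m * \<epsilon>"
    using assms(1,3) by (meson mult_pos_pos)
  have "dist (e (\<sigma> i)) (e (\<sigma> j)) < \<epsilon>" if "i \<ge> N" "j \<ge> N" for i j
  proof -
    have "m * dist (e (\<sigma> i)) (e (\<sigma> j)) < m * \<epsilon>"
      using N that assms(2) order_le_less_trans by blast
    then show ?thesis using \<open>m > 0\<close> by simp
  qed
  then show "\<exists>M. \<forall>i\<ge>M. \<forall>j\<ge>M. dist (e (\<sigma> i)) (e (\<sigma> j)) < \<epsilon>" by blast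
qed

text \<open>
  By the lower bound, a Cauchy sequence is Cauchy in the coordinate along the cylinder and in the
  unit circle; both factors are complete. By the upper bound, convergence there implies
  convergence in the induced distance, once the angle is chosen as the representative
  \<open>normalize_angle\<close> of least absolute value relative to the limit angle.
\<close>
lemma complete_if_comparable_to_flat:
  assumes cont: "\<And>v. continuous_on UNIV (\<lambda>q. frechet_derivative X (at q) v)"
    and lower: "\<And>q v. m * norm v \<le> norm (frechet_derivative X (at q) v)"
    and upper: "\<And>q v. norm (frechet_derivative X (at q) v) \<le> M * norm v"
    and "m > 0"
  shows "complete_cylinder X"
  unfolding complete_cylinder_def
proof (intro allI impI)
  fix \<sigma> :: "nat \<Rightarrow> real \<times> real"
  assume \<sigma>: "\<forall>\<epsilon>>0. \<exists>N. \<forall>i\<ge>N. \<forall>j\<ge>N. induced_dist X (\<sigma> i) (\<sigma> j) < \<epsilon>"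
  have ge_fst: "m * dist (fst p) (fst q) \<le> induced_dist X p q" for p q
    by (rule induced_dist_ge[OF cont lower \<open>m > 0\<close>])
      (auto simp: dist_fst_le same_point_def)
  have ge_cis: "m * dist (cis (snd p)) (cis (snd q)) \<le> induced_dist X p q" for p q
  proof (rule induced_dist_ge[OF cont lower \<open>m > 0\<close>])
    show "dist (cis (snd p)) (cis (snd q)) \<le> dist p q" for p q :: "real \<times> real"
      using dist_cis_le dist_snd_le order_trans by blast
    show "cis (snd p) = cis (snd q)" if "same_point p q" for p q
      using that by (auto simp: same_point_def simp flip: cis_mult)
  qed
  obtain s where s: "(\<lambda>n. fst (\<sigma> n)) \<longlonglongrightarrow> s"
    using Cauchy_comparison[where e=fst and D="induced_dist X" and \<sigma>=\<sigma>, OF \<open>m > 0\<close> ge_fst \<sigma>]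
      Cauchy_convergent convergent_def by blast
  obtain z where z: "(\<lambda>n. cis (snd (\<sigma> n))) \<longlonglongrightarrow> z"
    using Cauchy_comparison[where e="\<lambda>q. cis (snd q)" and D="induced_dist X" and \<sigma>=\<sigma>, OF \<open>m > 0\<close> ge_cis \<sigma>]
      Cauchy_convergent convergent_def by blast
  have "norm z = 1"
    using LIMSEQ_unique[OF tendsto_norm[OF z]] by simp
  then obtain a where a: "z = cis a"
    by (metis complex_norm_eq_1_exp cis_conv_exp)
  define \<delta> where "\<delta> n = normalize_angle (snd (\<sigma> n) - a)" for n
  have "(\<lambda>n. cis (snd (\<sigma> n)) * cis (- a)) \<longlonglongrightarrow> z * cis (- a)"
    by (intro tendsto_intros z)
  then have "(\<lambda>n. cis (snd (\<sigma> n) - a)) \<longlonglongrightarrow> 1"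
    by (simp add: a cis_mult)
  then have "(\<lambda>n. Arg (cis (snd (\<sigma> n) - a))) \<longlonglongrightarrow> Arg 1"
    by (intro tendsto_Arg) auto
  moreover have "Arg (cis (snd (\<sigma> n) - a)) = \<delta> n" for n
    using Arg_rcis'[of 1] by (simp add: \<delta>_def rcis_def)
  ultimately have \<delta>: "\<delta> \<longlonglongrightarrow> 0"
    by (simp add: Arg_1)
  have "(\<lambda>n. induced_dist X (\<sigma> n) (s, a)) \<longlonglongrightarrow> 0"
  proof (rule tendsto_sandwich)
    show "\<forall>\<^sub>F n in sequentially. 0 \<le> induced_dist X (\<sigma> n) (s, a)"
      using ge_fst \<open>m > 0\<close> by (meson always_eventually mult_nonneg_nonneg order_less_imp_le order_trans zero_le_dist)
    have "induced_dist X (\<sigma> n) (s, a) \<le> M * dist (fst (\<sigma> n), \<delta> n) (s, 0)" for n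
    proof -
      define k where "k = \<lceil>(snd (\<sigma> n) - a) / (2 * pi) - 1 / 2\<rceil>"
      have \<delta>k: "snd (\<sigma> n) = \<delta> n + a + 2 * pi * of_int k"
        by (simp add: \<delta>_def normalize_angle_def k_def)
      have "same_point (s, a + 2 * pi * of_int k) (s, a)"
        by (auto simp: same_point_def intro!: exI[of _ "- k"])
      from induced_dist_le[OF cont upper this, of "\<sigma> n"]
      have "induced_dist X (\<sigma> n) (s, a) \<le> M * dist (\<sigma> n) (s, a + 2 * pi * of_int k)" .
      also have "dist (\<sigma> n) (s, a + 2 * pi * of_int k) = dist (fst (\<sigma> n), \<delta> n) (s, 0)"
        by (simp add: dist_prod_def dist_real_def \<delta>k)
      finally show ?thesis .
    qed
    then show "\<forall>\<^sub>F n in sequentially.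
        induced_dist X (\<sigma> n) (s, a) \<le> M * dist (fst (\<sigma> n), \<delta> n) (s, 0)"
      by simp
    have "(\<lambda>n. M * dist (fst (\<sigma> n), \<delta> n) (s, 0)) \<longlonglongrightarrow> M * dist (s, 0::real) (s, 0)"
      by (intro tendsto_intros s \<delta>)
    then show "(\<lambda>n. M * dist (fst (\<sigma> n), \<delta> n) (s, 0)) \<longlonglongrightarrow> 0"
      by simp
  qed auto
  then show "\<exists>p. (\<lambda>n. induced_dist X (\<sigma> n) p) \<longlonglongrightarrow> 0" ..
qed

section \<open>The profile curve\<close>

text \<open>
  The parameter \<open>s\<close> is the angle between the tangent of the profile curve and the horizontal
  direction, not the arc length. In this parameter \<open>y = sin s\<close>, and the larger solution of
  \<open>(x - y)\<^sup>2 + y\<^sup>2 = \<rho>\<^sup>2 + 1\<close> is \<open>x = y + root_fn \<rho> s\<close>. Writing the constant of integration as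
  \<open>\<rho>\<^sup>2 + 1\<close> makes the radicand \<open>\<rho>\<^sup>2 + (cos s)\<^sup>2\<close>, which is bounded below by \<open>\<rho>\<^sup>2\<close>.
\<close>
definition root_fn :: "real \<Rightarrow> real \<Rightarrow> real" where
  "root_fn \<rho> s = sqrt (\<rho>\<^sup>2 + (cos s)\<^sup>2)"

definition radius :: "real \<Rightarrow> real \<Rightarrow> real" where
  "radius \<rho> s = sin s + root_fn \<rho> s"

text \<open>
  The derivative of arc length with respect to the tangent angle, so that \<open>1 / speed\<close> is the
  curvature of the profile curve.
\<close>
definition speed :: "real \<Rightarrow> real \<Rightarrow> real" where
  "speed \<rho> s = 1 - sin s / root_fn \<rho> s"

text \<open>
  The non-periodic part of the height. A primitive on the whole line is chosen instead of an
  integral from \<open>0\<close>, which would have to be treated separately for negative bounds. Only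
  differences of its values enter geometrically.
\<close>
definition drift :: "real \<Rightarrow> real \<Rightarrow> real" where
  "drift \<rho> = (SOME G. \<forall>s. (G has_real_derivative (sin s)\<^sup>2 / root_fn \<rho> s) (at s))"

definition height :: "real \<Rightarrow> real \<Rightarrow> real" where
  "height \<rho> s = - cos s - drift \<rho> s"

context
  fixes \<rho> :: real
  assumes \<rho>: "2 \<le> \<rho>"
begin

lemma root_fn_ge: "\<rho> \<le> root_fn \<rho> s"
  using \<rho> by (simp add: root_fn_def real_le_rsqrt)

lemma root_fn_pos: "0 < root_fn \<rho> s"
  using root_fn_ge[of s] \<rho> by linarith

lemma root_fn_le: "root_fn \<rho> s \<le> \<rho> + 1"
proof -
  have "(cos s)\<^sup>2 \<le> 1"
    by (simp add: abs_square_le_1)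
  then have "\<rho>\<^sup>2 + (cos s)\<^sup>2 \<le> (\<rho> + 1)\<^sup>2"
    using \<rho> by (simp add: power2_sum)
  then show ?thesis
    using \<rho> by (simp add: root_fn_def real_le_lsqrt)
qed

lemma root_fn_square: "(root_fn \<rho> s)\<^sup>2 = \<rho>\<^sup>2 + (cos s)\<^sup>2"
  by (simp add: root_fn_def)

lemma radius_bounds: "1 \<le> radius \<rho> s" "radius \<rho> s \<le> \<rho> + 2"
  using root_fn_ge[of s] root_fn_le[of s] \<rho> sin_ge_minus_one[of s] sin_le_one[of s]
  unfolding radius_def by linarith+

text \<open>
  The root is at least \<open>\<rho>\<close> and \<open>\<bar>sin s\<bar> \<le> 1\<close>. That \<open>speed\<close> stays positive is what makes the tangent
  angle a regular parameter for the whole curve.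
\<close>
lemma speed_bounds: "1 / 2 \<le> speed \<rho> s" "speed \<rho> s \<le> 2"
proof -
  have "\<bar>sin s\<bar> \<le> 1 / 2 * root_fn \<rho> s"
    using root_fn_ge[of s] \<rho> abs_sin_le_one[of s] by linarith
  then have "\<bar>sin s / root_fn \<rho> s\<bar> \<le> 1 / 2"
    using root_fn_pos[of s] by (simp add: field_simps)
  then show "1 / 2 \<le> speed \<rho> s" "speed \<rho> s \<le> 2"
    unfolding speed_def by linarith+
qed

lemma root_fn_deriv:
  "(root_fn \<rho> has_real_derivative - (sin s * cos s * inverse (root_fn \<rho> s))) (at s)"
proof -
  have "\<rho>\<^sup>2 + (cos s)\<^sup>2 > 0"
    using root_fn_pos[of s] by (simp add: root_fn_def)
  then show ?thesis
    unfolding root_fn_def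
    by (auto intro!: derivative_eq_intros simp: divide_simps)
qed

lemma drift_deriv: "(drift \<rho> has_real_derivative (sin s)\<^sup>2 / root_fn \<rho> s) (at s)"
proof -
  have "isCont (\<lambda>s. (sin s)\<^sup>2 / root_fn \<rho> s) s" for s
    using root_fn_pos[of s] DERIV_isCont[OF root_fn_deriv] by (intro continuous_intros) auto
  then have "\<exists>G. \<forall>s. - \<infinity> < ereal s \<longrightarrow> ereal s < \<infinity> \<longrightarrow>
      (G has_vector_derivative (sin s)\<^sup>2 / root_fn \<rho> s) (at s)"
    by (intro einterval_antiderivative) auto
  then have "\<exists>G. \<forall>s. (G has_real_derivative (sin s)\<^sup>2 / root_fn \<rho> s) (at s)"
    by (simp add: has_real_derivative_iff_has_vector_derivative)
  from someI_ex[OF this] show ?thesis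
    unfolding drift_def by blast
qed

lemma radius_deriv: "(radius \<rho> has_real_derivative speed \<rho> s * cos s) (at s)"
  unfolding radius_def speed_def
  by (auto intro!: derivative_eq_intros root_fn_deriv simp: field_simps)

lemma height_deriv: "(height \<rho> has_real_derivative speed \<rho> s * sin s) (at s)"
  unfolding height_def speed_def
  by (auto intro!: derivative_eq_intros drift_deriv simp: field_simps power2_eq_square)

end

section \<open>Curvatures of the surface of revolution\<close>

definition surf :: "real \<Rightarrow> real \<times> real \<Rightarrow> real^3" where
  "surf \<rho> q = vector [radius \<rho> (fst q) * cos (snd q), radius \<rho> (fst q) * sin (snd q),
     height \<rho> (fst q)]"

definition frame1 :: "real \<times> real \<Rightarrow> real^3" where
  "frame1 q = vector [cos (fst q) * cos (snd q), cos (fst q) * sin (snd q), sin (fst q)]"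

definition frame2 :: "real \<times> real \<Rightarrow> real^3" where
  "frame2 q = vector [- sin (snd q), cos (snd q), 0]"

lemma has_derivative_vector_3:
  fixes f g h :: "'a::real_normed_vector \<Rightarrow> real"
  assumes "(f has_derivative f') F" "(g has_derivative g') F" "(h has_derivative h') F"
  shows "((\<lambda>q. vector [f q, g q, h q] :: real^3) has_derivative
           (\<lambda>v. vector [f' v, g' v, h' v])) F"
proof -
  have *: "(vector [a, b, c] :: real^3) =
      a *\<^sub>R vector [1, 0, 0] + b *\<^sub>R vector [0, 1, 0] + c *\<^sub>R vector [0, 0, 1]" for a b c :: real
    by (simp add: vec_eq_iff forall_3)
  have "((\<lambda>q. f q *\<^sub>R vector [1, 0, 0] + g q *\<^sub>R vector [0, 1, 0] + h q *\<^sub>R vector [0, 0, 1] :: real^3)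
     has_derivative (\<lambda>v. f' v *\<^sub>R vector [1, 0, 0] + g' v *\<^sub>R vector [0, 1, 0]
       + h' v *\<^sub>R vector [0, 0, 1])) F"
    by (intro derivative_intros assms)
  then show ?thesis
    by (simp only: *[symmetric])
qed

lemma frame_inner:
  "frame1 q \<bullet> frame1 q = 1" "frame2 q \<bullet> frame2 q = 1"
  "frame1 q \<bullet> frame2 q = 0" "frame2 q \<bullet> frame1 q = 0"
proof -
  have "(cos a * cos b)\<^sup>2 + (cos a * sin b)\<^sup>2 + (sin a)\<^sup>2 = 1" for a b :: real
  proof -
    have "(cos a * cos b)\<^sup>2 + (cos a * sin b)\<^sup>2 = (cos a)\<^sup>2 * ((sin b)\<^sup>2 + (cos b)\<^sup>2)"
      by (simp only: power_mult_distrib distrib_left add.commute)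
    then show ?thesis by (simp only: sin_cos_squared_add) simp
  qed
  then show "frame1 q \<bullet> frame1 q = 1"
    by (simp add: frame1_def inner_vec_def sum_3 power2_eq_square)
  show "frame2 q \<bullet> frame2 q = 1"
    by (simp add: frame2_def inner_vec_def sum_3 flip: power2_eq_square)
  show "frame1 q \<bullet> frame2 q = 0" "frame2 q \<bullet> frame1 q = 0"
    by (simp_all add: frame1_def frame2_def inner_vec_def sum_3)
qed

lemma frame_comb_eq_iff:
  "a *\<^sub>R frame1 q + b *\<^sub>R frame2 q = c *\<^sub>R frame1 q + d *\<^sub>R frame2 q \<longleftrightarrow> a = c \<and> b = d"
proof
  assume eq: "a *\<^sub>R frame1 q + b *\<^sub>R frame2 q = c *\<^sub>R frame1 q + d *\<^sub>R frame2 q"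
  from arg_cong[OF this, of "\<lambda>x. x \<bullet> frame1 q"] arg_cong[OF this, of "\<lambda>x. x \<bullet> frame2 q"]
  show "a = c \<and> b = d"
    by (simp add: inner_add_left frame_inner)
qed simp

lemma norm_frame_comb: "(norm (a *\<^sub>R frame1 q + b *\<^sub>R frame2 q))\<^sup>2 = a\<^sup>2 + b\<^sup>2"
  unfolding power2_norm_eq_inner
  by (simp add: inner_add_left inner_add_right frame_inner power2_eq_square)

lemma frame_cross:
  "cross3 (frame1 q) (frame2 q) =
    vector [- (sin (fst q) * cos (snd q)), - (sin (fst q) * sin (snd q)), cos (fst q)]"
proof -
  have "cos a * cos b * cos b + cos a * sin b * sin b = cos a" for a b :: real
    using sin_cos_squared_add[of b] by algebra
  then show ?thesis
    by (simp add: cross3_def frame1_def frame2_def)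
qed

lemma norm_frame_cross: "norm (cross3 (frame1 q) (frame2 q)) = 1"
proof -
  have "(norm (cross3 (frame1 q) (frame2 q)))\<^sup>2 = 1"
    using norm_cross_dot[of "frame1 q" "frame2 q"]
    by (simp add: frame_inner power2_norm_eq_inner power_mult_distrib)
  then show ?thesis
    by (metis abs_norm_cancel abs_square_eq_1)
qed

context
  fixes \<rho> :: real
  assumes \<rho>: "2 \<le> \<rho>"
begin

text \<open>
  Along \<open>frame1\<close>, the unit tangent of the meridian, and \<open>frame2\<close>, the unit tangent of the
  parallel, the differential is diagonal. So is that of the Gauss map below, and the principal
  curvatures are the quotients of the diagonal entries.
\<close>
lemma surf_has_derivative:
  "(surf \<rho> has_derivative (\<lambda>v. (speed \<rho> (fst q) * fst v) *\<^sub>R frame1 q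
      + (radius \<rho> (fst q) * snd v) *\<^sub>R frame2 q)) (at q)"
proof -
  note r = DERIV_compose_FDERIV[OF radius_deriv[OF \<rho>] has_derivative_fst[OF has_derivative_ident], of q]
  note h = DERIV_compose_FDERIV[OF height_deriv[OF \<rho>] has_derivative_fst[OF has_derivative_ident], of q]
  note c = DERIV_compose_FDERIV[OF DERIV_cos has_derivative_snd[OF has_derivative_ident], of q]
  note s = DERIV_compose_FDERIV[OF DERIV_sin has_derivative_snd[OF has_derivative_ident], of q]
  show ?thesis
    unfolding surf_def
    by (rule has_derivative_eq_rhs[OF has_derivative_vector_3
          [OF has_derivative_mult[OF r c] has_derivative_mult[OF r s] h]])
      (simp add: fun_eq_iff frame1_def frame2_def vec_eq_iff forall_3 algebra_simps)
qed

lemma surf_frechet: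
  "frechet_derivative (surf \<rho>) (at q) v =
     (speed \<rho> (fst q) * fst v) *\<^sub>R frame1 q + (radius \<rho> (fst q) * snd v) *\<^sub>R frame2 q"
  by (simp only: frechet_derivative_at[OF surf_has_derivative[of q], symmetric])

lemma surf_frechet_norm:
  "(norm (frechet_derivative (surf \<rho>) (at q) v))\<^sup>2 =
     (speed \<rho> (fst q) * fst v)\<^sup>2 + (radius \<rho> (fst q) * snd v)\<^sup>2"
  by (simp only: surf_frechet norm_frame_comb)

lemma surf_gauss_map: "gauss_map (surf \<rho>) q = cross3 (frame1 q) (frame2 q)"
proof -
  have "speed \<rho> (fst q) * radius \<rho> (fst q) > 0"
    using speed_bounds(1)[OF \<rho>, of "fst q"] radius_bounds(1)[OF \<rho>, of "fst q"] by simp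
  then have "sgn (speed \<rho> (fst q) * radius \<rho> (fst q)) = 1"
    by (rule sgn_pos)
  moreover have "gauss_map (surf \<rho>) q =
      sgn ((speed \<rho> (fst q) * radius \<rho> (fst q)) *\<^sub>R cross3 (frame1 q) (frame2 q))"
    unfolding gauss_map_def surf_frechet by (simp add: cross_mult_left cross_mult_right mult.commute)
  ultimately show ?thesis
    by (simp add: sgn_scaleR sgn_div_norm[of "cross3 _ _"] norm_frame_cross)
qed

lemma gauss_map_has_derivative:
  "(gauss_map (surf \<rho>) has_derivative
     (\<lambda>v. (- fst v) *\<^sub>R frame1 q + (- sin (fst q) * snd v) *\<^sub>R frame2 q)) (at q)"
proof -
  note cs = DERIV_compose_FDERIV[OF DERIV_cos has_derivative_fst[OF has_derivative_ident], of q]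
  note ss = DERIV_compose_FDERIV[OF DERIV_sin has_derivative_fst[OF has_derivative_ident], of q]
  note c = DERIV_compose_FDERIV[OF DERIV_cos has_derivative_snd[OF has_derivative_ident], of q]
  note s = DERIV_compose_FDERIV[OF DERIV_sin has_derivative_snd[OF has_derivative_ident], of q]
  show ?thesis
    unfolding surf_gauss_map[abs_def] frame_cross
    by (rule has_derivative_eq_rhs[OF has_derivative_vector_3
          [OF has_derivative_minus[OF has_derivative_mult[OF ss c]]
              has_derivative_minus[OF has_derivative_mult[OF ss s]] cs]])
      (simp add: fun_eq_iff frame1_def frame2_def vec_eq_iff forall_3 algebra_simps)
qed

lemma surf_principal_curvatures:
  "principal_curvatures (surf \<rho>) q = {1 / speed \<rho> (fst q), sin (fst q) / radius \<rho> (fst q)}"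
proof -
  define s where "s = fst q"
  have pos: "speed \<rho> s > 0" "radius \<rho> s > 0"
    using speed_bounds(1)[OF \<rho>, of s] radius_bounds(1)[OF \<rho>, of s] by linarith+
  have "- frechet_derivative (gauss_map (surf \<rho>)) (at q) v = \<kappa> *\<^sub>R frechet_derivative (surf \<rho>) (at q) v
     \<longleftrightarrow> fst v = \<kappa> * speed \<rho> s * fst v \<and> sin s * snd v = \<kappa> * radius \<rho> s * snd v" for \<kappa> v
  proof -
    have "- frechet_derivative (gauss_map (surf \<rho>)) (at q) v = fst v *\<^sub>R frame1 q + (sin s * snd v) *\<^sub>R frame2 q"
      using frechet_derivative_at[OF gauss_map_has_derivative[of q], symmetric] by (simp add: s_def)
    moreover have "\<kappa> *\<^sub>R frechet_derivative (surf \<rho>) (at q) v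
        = (\<kappa> * speed \<rho> s * fst v) *\<^sub>R frame1 q + (\<kappa> * radius \<rho> s * snd v) *\<^sub>R frame2 q"
      by (simp add: surf_frechet s_def scaleR_add_right mult.assoc)
    ultimately show ?thesis
      by (simp only: frame_comb_eq_iff)
  qed
  then have "principal_curvatures (surf \<rho>) q =
      {\<kappa>. \<exists>v::real \<times> real. v \<noteq> 0 \<and> fst v = \<kappa> * speed \<rho> s * fst v \<and> sin s * snd v = \<kappa> * radius \<rho> s * snd v}"
    by (simp add: principal_curvatures_def)
  also have "\<dots> = {\<kappa>. \<kappa> * speed \<rho> s = 1 \<or> sin s = \<kappa> * radius \<rho> s}" (is "?L = ?R")
  proof
    show "?L \<subseteq> ?R" by (auto simp: zero_prod_def)
    show "?R \<subseteq> ?L"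
    proof
      fix \<kappa> assume "\<kappa> \<in> ?R"
      then consider "\<kappa> * speed \<rho> s = 1" | "sin s = \<kappa> * radius \<rho> s" by auto
      then show "\<kappa> \<in> ?L"
      proof cases
        case 1 then show ?thesis by (auto intro!: exI[of _ "(1, 0)"] simp: zero_prod_def)
      next
        case 2 then show ?thesis by (auto intro!: exI[of _ "(0, 1)"] simp: zero_prod_def)
      qed
    qed
  qed
  also have "\<dots> = {1 / speed \<rho> s, sin s / radius \<rho> s}"
    using pos by (auto simp: field_simps)
  finally show ?thesis by (simp add: s_def)
qed

text \<open>
  In the notation of the proof, multiplying the relation by \<open>w r\<close> turns it into
  \<open>- (r + y w) + 2 y = - w r\<close>, which follows from \<open>w R = R - y\<close> and \<open>r = y + R\<close> alone.
\<close>
lemma surf_linear_weingarten: "linear_weingarten (-2) 2 (-1) (surf \<rho>)"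
  unfolding linear_weingarten_def
proof
  fix q :: "real \<times> real"
  define R w r y where "R = root_fn \<rho> (fst q)" and "w = speed \<rho> (fst q)" and "r = radius \<rho> (fst q)"
    and "y = sin (fst q)"
  have pos: "w > 0" "r > 0" "R > 0"
    using speed_bounds(1)[OF \<rho>, of "fst q"] radius_bounds(1)[OF \<rho>, of "fst q"] root_fn_pos[OF \<rho>]
    by (auto simp: w_def r_def R_def)
  have "Min {a, b} + Max {a, b} = a + b" "Min {a, b} * Max {a, b} = a * b" for a b :: real
    by (auto simp: min_def max_def)
  then have HK: "mean_curvature (surf \<rho>) q = (1 / w + y / r) / 2" "gauss_curvature (surf \<rho>) q = 1 / w * (y / r)"
    unfolding mean_curvature_def gauss_curvature_def surf_principal_curvatures w_def r_def y_def by presburger+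
  have "w * R = R - y" "r = y + R"
    using pos by (auto simp: w_def r_def y_def R_def speed_def radius_def field_simps)
  then have "R * (- (r + y * w) + 2 * y) = R * (- (w * r))"
    by algebra
  then have "- (r + y * w) + 2 * y = - (w * r)"
    using pos by (metis mult_left_cancel less_irrefl)
  then show "-2 * mean_curvature (surf \<rho>) q + 2 * gauss_curvature (surf \<rho>) q = -1"
    using pos unfolding HK by (simp add: field_simps)
qed

end

section \<open>Smoothness, immersion and completeness\<close>

text \<open>
  The coordinate functions of the surface lie in an algebra of functions that is closed under
  partial derivatives; this yields derivatives of every order by one induction. The reciprocal of
  the root is among the generators because it occurs in the derivatives of the root and of the
  drift.
\<close>
inductive coord_alg :: "real \<Rightarrow> (real \<times> real \<Rightarrow> real) \<Rightarrow> bool" for \<rho> where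
  const: "coord_alg \<rho> (\<lambda>q. a)"
| sin_fst: "coord_alg \<rho> (\<lambda>q. sin (fst q))"
| cos_fst: "coord_alg \<rho> (\<lambda>q. cos (fst q))"
| root_fst: "coord_alg \<rho> (\<lambda>q. root_fn \<rho> (fst q))"
| inv_root_fst: "coord_alg \<rho> (\<lambda>q. inverse (root_fn \<rho> (fst q)))"
| drift_fst: "coord_alg \<rho> (\<lambda>q. drift \<rho> (fst q))"
| sin_snd: "coord_alg \<rho> (\<lambda>q. sin (snd q))"
| cos_snd: "coord_alg \<rho> (\<lambda>q. cos (snd q))"
| add: "coord_alg \<rho> f \<Longrightarrow> coord_alg \<rho> g \<Longrightarrow> coord_alg \<rho> (\<lambda>q. f q + g q)"
| mult: "coord_alg \<rho> f \<Longrightarrow> coord_alg \<rho> g \<Longrightarrow> coord_alg \<rho> (\<lambda>q. f q * g q)"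

lemma coord_alg_minus: "coord_alg \<rho> f \<Longrightarrow> coord_alg \<rho> (\<lambda>q. - f q)"
  using coord_alg.mult[OF coord_alg.const[of \<rho> "-1"]] by fastforce

text \<open>
  Besides the derivative formula this records that the two partial derivatives are again in the
  algebra.
\<close>
definition has_partials where
  "has_partials \<rho> f p r \<longleftrightarrow> coord_alg \<rho> p \<and> coord_alg \<rho> r \<and>
     (\<forall>q. (f has_derivative (\<lambda>v. p q * fst v + r q * snd v)) (at q))"

lemma has_partials_fst:
  assumes "\<And>s. (g has_real_derivative g' s) (at s)" and "coord_alg \<rho> (\<lambda>q. g' (fst q))"
  shows "has_partials \<rho> (\<lambda>q. g (fst q)) (\<lambda>q. g' (fst q)) (\<lambda>q. 0)"
  using DERIV_compose_FDERIV[OF assms(1) has_derivative_fst[OF has_derivative_ident]] assms(2)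
  by (auto simp: has_partials_def mult.commute intro: coord_alg.const)

lemma has_partials_snd:
  assumes "\<And>s. (g has_real_derivative g' s) (at s)" and "coord_alg \<rho> (\<lambda>q. g' (snd q))"
  shows "has_partials \<rho> (\<lambda>q. g (snd q)) (\<lambda>q. 0) (\<lambda>q. g' (snd q))"
  using DERIV_compose_FDERIV[OF assms(1) has_derivative_snd[OF has_derivative_ident]] assms(2)
  by (auto simp: has_partials_def mult.commute intro: coord_alg.const)

lemma coord_alg_partials:
  assumes \<rho>: "2 \<le> \<rho>" and "coord_alg \<rho> f"
  shows "\<exists>p r. has_partials \<rho> f p r"
  using assms(2)
proof induction
  case (const a)
  have "has_partials \<rho> (\<lambda>q. a) (\<lambda>q. 0) (\<lambda>q. 0)"
    by (simp add: has_partials_def coord_alg.const)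
  then show ?case by blast
next
  case sin_fst
  show ?case using has_partials_fst[OF DERIV_sin coord_alg.cos_fst] by blast
next
  case cos_fst
  show ?case using has_partials_fst[OF DERIV_cos coord_alg_minus[OF coord_alg.sin_fst]] by blast
next
  case sin_snd
  show ?case using has_partials_snd[OF DERIV_sin coord_alg.cos_snd] by blast
next
  case cos_snd
  show ?case using has_partials_snd[OF DERIV_cos coord_alg_minus[OF coord_alg.sin_snd]] by blast
next
  case root_fst
  have "coord_alg \<rho> (\<lambda>q. - (sin (fst q) * cos (fst q) * inverse (root_fn \<rho> (fst q))))"
    by (intro coord_alg_minus coord_alg.intros)
  from has_partials_fst[OF root_fn_deriv[OF \<rho>] this] show ?case by blast
next
  case inv_root_fst
  have "((\<lambda>s. inverse (root_fn \<rho> s)) has_real_derivative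
      sin s * cos s * (inverse (root_fn \<rho> s) * (inverse (root_fn \<rho> s) * inverse (root_fn \<rho> s)))) (at s)" for s
    using root_fn_pos[OF \<rho>, of s]
    by (auto intro!: derivative_eq_intros root_fn_deriv[OF \<rho>] simp: field_simps)
  then have "has_partials \<rho> (\<lambda>q. inverse (root_fn \<rho> (fst q))) (\<lambda>q. sin (fst q) * cos (fst q) *
      (inverse (root_fn \<rho> (fst q)) * (inverse (root_fn \<rho> (fst q)) * inverse (root_fn \<rho> (fst q))))) (\<lambda>q. 0)"
    by (rule has_partials_fst) (intro coord_alg.intros)
  then show ?case by blast
next
  case drift_fst
  have "coord_alg \<rho> (\<lambda>q. (sin (fst q))\<^sup>2 / root_fn \<rho> (fst q))"
    unfolding power2_eq_square divide_inverse by (intro coord_alg.intros)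
  from has_partials_fst[OF drift_deriv[OF \<rho>] this] show ?case by blast
next
  case (add f g)
  then obtain p r p' r' where *: "has_partials \<rho> f p r" "has_partials \<rho> g p' r'" by blast
  have "has_partials \<rho> (\<lambda>q. f q + g q) (\<lambda>q. p q + p' q) (\<lambda>q. r q + r' q)"
    unfolding has_partials_def
  proof (intro conjI allI)
    fix q
    have "((\<lambda>q. f q + g q) has_derivative
        (\<lambda>v. (p q * fst v + r q * snd v) + (p' q * fst v + r' q * snd v))) (at q)"
      using * by (intro has_derivative_add) (simp_all add: has_partials_def del: split_paired_All)
    then show "((\<lambda>q. f q + g q) has_derivative
        (\<lambda>v. (p q + p' q) * fst v + (r q + r' q) * snd v)) (at q)"
      by (simp add: algebra_simps)
  qed (use * in \<open>auto simp: has_partials_def intro!: coord_alg.add\<close>)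
  then show ?case by blast
next
  case (mult f g)
  then obtain p r p' r' where *: "has_partials \<rho> f p r" "has_partials \<rho> g p' r'" by blast
  have "has_partials \<rho> (\<lambda>q. f q * g q) (\<lambda>q. f q * p' q + p q * g q) (\<lambda>q. f q * r' q + r q * g q)"
    unfolding has_partials_def
  proof (intro conjI allI)
    fix q
    have "((\<lambda>q. f q * g q) has_derivative
        (\<lambda>v. f q * (p' q * fst v + r' q * snd v) + (p q * fst v + r q * snd v) * g q)) (at q)"
      using * by (intro has_derivative_mult) (simp_all add: has_partials_def del: split_paired_All)
    then show "((\<lambda>q. f q * g q) has_derivative
        (\<lambda>v. (f q * p' q + p q * g q) * fst v + (f q * r' q + r q * g q) * snd v)) (at q)"
      by (simp add: algebra_simps)
  qed (use * mult in \<open>auto simp: has_partials_def intro!: coord_alg.add coord_alg.mult\<close>)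
  then show ?case by blast
qed

lemma Ck_coord_alg:
  assumes \<rho>: "2 \<le> \<rho>"
  shows "coord_alg \<rho> f \<Longrightarrow> coord_alg \<rho> g \<Longrightarrow> coord_alg \<rho> h \<Longrightarrow>
    Ck k (\<lambda>q. vector [f q, g q, h q] :: real^3)"
proof (induction k arbitrary: f g h)
  case (0 f g h)
  obtain p r p' r' p'' r'' where "has_partials \<rho> f p r" "has_partials \<rho> g p' r'" "has_partials \<rho> h p'' r''"
    using coord_alg_partials[OF \<rho>] 0 by meson
  then have "((\<lambda>q. vector [f q, g q, h q] :: real^3) has_derivative
     (\<lambda>v. vector [p q * fst v + r q * snd v, p' q * fst v + r' q * snd v, p'' q * fst v + r'' q * snd v])) (at q)" for q
    by (intro has_derivative_vector_3) (simp_all add: has_partials_def del: split_paired_All)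
  then show ?case
    by (auto intro!: continuous_at_imp_continuous_on has_derivative_continuous)
next
  case (Suc k f g h)
  obtain p r p' r' p'' r'' where *: "has_partials \<rho> f p r" "has_partials \<rho> g p' r'" "has_partials \<rho> h p'' r''"
    using coord_alg_partials[OF \<rho>] Suc.prems by meson
  then have D: "((\<lambda>q. vector [f q, g q, h q] :: real^3) has_derivative
     (\<lambda>v. vector [p q * fst v + r q * snd v, p' q * fst v + r' q * snd v, p'' q * fst v + r'' q * snd v])) (at q)" for q
    by (intro has_derivative_vector_3) (simp_all add: has_partials_def del: split_paired_All)
  have "Ck k (\<lambda>q. vector [p q * fst v + r q * snd v, p' q * fst v + r' q * snd v, p'' q * fst v + r'' q * snd v] :: real^3)" for v
    using * by (intro Suc.IH coord_alg.add coord_alg.mult coord_alg.const) (auto simp: has_partials_def)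
  then show ?case
    using D by (simp add: frechet_derivative_at[OF D, symmetric]) (meson differentiable_def)
qed

context
  fixes \<rho> :: real
  assumes \<rho>: "2 \<le> \<rho>"
begin

lemma surf_smooth: "Ck k (surf \<rho>)"
proof -
  have "coord_alg \<rho> (\<lambda>q. (sin (fst q) + root_fn \<rho> (fst q)) * cos (snd q))"
    "coord_alg \<rho> (\<lambda>q. (sin (fst q) + root_fn \<rho> (fst q)) * sin (snd q))"
    "coord_alg \<rho> (\<lambda>q. - cos (fst q) + - drift \<rho> (fst q))"
    by (intro coord_alg.intros coord_alg_minus)+
  from Ck_coord_alg[OF \<rho> this] show ?thesis
    by (simp add: surf_def[abs_def] radius_def height_def)
qed

lemma surf_frechet_bounds:
  "1 / 2 * norm v \<le> norm (frechet_derivative (surf \<rho>) (at q) v)"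
  "norm (frechet_derivative (surf \<rho>) (at q) v) \<le> (\<rho> + 2) * norm v"
proof -
  have w: "(1/2)\<^sup>2 \<le> (speed \<rho> (fst q))\<^sup>2" "(speed \<rho> (fst q))\<^sup>2 \<le> (\<rho> + 2)\<^sup>2"
    using speed_bounds[OF \<rho>, of "fst q"] \<rho> by (auto intro!: power_mono)
  have r: "(1/2)\<^sup>2 \<le> (radius \<rho> (fst q))\<^sup>2" "(radius \<rho> (fst q))\<^sup>2 \<le> (\<rho> + 2)\<^sup>2"
    using radius_bounds[OF \<rho>, of "fst q"] \<rho> by (auto intro!: power_mono)
  have nv: "(norm v)\<^sup>2 = (fst v)\<^sup>2 + (snd v)\<^sup>2"
    by (simp add: norm_prod_def)
  have "(1 / 2 * norm v)\<^sup>2 \<le> (norm (frechet_derivative (surf \<rho>) (at q) v))\<^sup>2"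
    unfolding surf_frechet_norm[OF \<rho>] power_mult_distrib nv distrib_left
    using w r by (intro add_mono mult_right_mono) auto
  then show "1 / 2 * norm v \<le> norm (frechet_derivative (surf \<rho>) (at q) v)"
    by (rule power2_le_imp_le) simp
  have "(norm (frechet_derivative (surf \<rho>) (at q) v))\<^sup>2 \<le> ((\<rho> + 2) * norm v)\<^sup>2"
    unfolding surf_frechet_norm[OF \<rho>] power_mult_distrib nv distrib_left
    using w r by (intro add_mono mult_right_mono) auto
  then show "norm (frechet_derivative (surf \<rho>) (at q) v) \<le> (\<rho> + 2) * norm v"
    by (rule power2_le_imp_le) (use \<rho> in simp)
qed

lemma surf_complete: "complete_cylinder (surf \<rho>)"
proof (rule complete_if_comparable_to_flat[OF _ surf_frechet_bounds])
  show "continuous_on UNIV (\<lambda>q. frechet_derivative (surf \<rho>) (at q) v)" for v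
    using surf_smooth[of "Suc 0"] by (simp del: split_paired_All)
qed simp

lemma surf_immersed: "immersed_cylinder (surf \<rho>)"
  unfolding immersed_cylinder_def
proof (intro conjI allI impI)
  fix q q' assume "same_point q q'"
  then obtain k :: int where "fst q' = fst q" "snd q' = snd q + 2 * pi * of_int k"
    by (auto simp: same_point_def)
  then show "surf \<rho> q = surf \<rho> q'"
    by (simp add: surf_def sin_add cos_add)
next
  fix q
  have "linear (frechet_derivative (surf \<rho>) (at q))"
    using surf_has_derivative[OF \<rho>] by (intro linear_frechet_derivative differentiableI)
  moreover have "v = 0" if "frechet_derivative (surf \<rho>) (at q) v = 0" for v
    using surf_frechet_bounds(1)[of v q] that by simp
  ultimately show "inj (frechet_derivative (surf \<rho>) (at q))"
    by (simp add: linear_injective_0)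
qed (rule surf_smooth)

end

section \<open>Rotational symmetry, period and self-intersection\<close>

text \<open>
  The amount by which the height falls during one turn of the tangent, since \<open>- cos\<close> contributes
  nothing to it.
\<close>
definition period :: "real \<Rightarrow> real" where
  "period \<rho> = drift \<rho> (2 * pi) - drift \<rho> 0"

context
  fixes \<rho> :: real
  assumes \<rho>: "2 \<le> \<rho>"
begin

lemma root_fn_periodic: "root_fn \<rho> (s + 2 * pi) = root_fn \<rho> s"
  by (simp add: root_fn_def)

lemma drift_mono_strict: "drift \<rho> 0 < drift \<rho> pi"
proof (rule DERIV_pos_imp_increasing_open[where f = "drift \<rho>"])
  show "\<exists>y. (drift \<rho> has_real_derivative y) (at x) \<and> 0 < y" if "0 < x" "x < pi" for x
    using drift_deriv[OF \<rho>, of x] sin_gt_zero[OF that] root_fn_pos[OF \<rho>, of x]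
    by (intro exI[of _ "(sin x)\<^sup>2 / root_fn \<rho> x"]) auto
  show "continuous_on {0..pi} (drift \<rho>)"
    using drift_deriv[OF \<rho>] by (meson DERIV_isCont continuous_at_imp_continuous_on)
qed simp

lemma period_pos: "0 < period \<rho>"
proof -
  have "drift \<rho> pi \<le> drift \<rho> (2 * pi)"
    by (rule DERIV_nonneg_imp_nondecreasing[where f = "drift \<rho>"])
      (use drift_deriv[OF \<rho>] root_fn_pos[OF \<rho>] in \<open>auto intro!: exI divide_nonneg_pos\<close>)
  then show ?thesis
    using drift_mono_strict by (simp add: period_def)
qed

lemma drift_add_2pi: "drift \<rho> (s + 2 * pi) = drift \<rho> s + period \<rho>"
proof -
  have "((\<lambda>s. drift \<rho> (s + 2 * pi) - drift \<rho> s) has_real_derivative 0) (at s)" for s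
    using DERIV_diff[OF DERIV_shift[THEN iffD1, OF drift_deriv[OF \<rho>, of "s + 2 * pi"]] drift_deriv[OF \<rho>, of s]]
    by (simp add: root_fn_periodic)
  then have "drift \<rho> (s + 2 * pi) - drift \<rho> s = drift \<rho> (0 + 2 * pi) - drift \<rho> 0"
    by (intro DERIV_isconst_all) auto
  then show ?thesis by (simp add: period_def)
qed

lemma height_add_2pi_int: "height \<rho> (s + 2 * pi * of_int k) = height \<rho> s - of_int k * period \<rho>"
proof -
  have nat: "drift \<rho> (s + 2 * pi * of_nat n) = drift \<rho> s + of_nat n * period \<rho>" for n s
  proof (induction n)
    case (Suc n)
    then show ?case using drift_add_2pi[of "s + 2 * pi * of_nat n"] by (simp add: algebra_simps)
  qed simp
  have "drift \<rho> (s + 2 * pi * of_int k) = drift \<rho> s + of_int k * period \<rho>"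
  proof (cases k rule: int_cases2)
    case (nonneg n) then show ?thesis using nat by simp
  next
    case (nonpos n) then show ?thesis using nat[of "s - 2 * pi * of_nat n" n] by simp
  qed
  then show ?thesis by (simp add: height_def cos_add)
qed

lemma radius_add_2pi_int: "radius \<rho> (s + 2 * pi * of_int k) = radius \<rho> s"
  by (simp add: radius_def root_fn_def sin_add cos_add)

lemma surf_add_2pi_int: "surf \<rho> (s + 2 * pi * of_int k, \<phi>) =
    surf \<rho> (s, \<phi>) - (of_int k * period \<rho>) *\<^sub>R vector [0, 0, 1]"
  by (simp add: surf_def radius_add_2pi_int height_add_2pi_int vec_eq_iff forall_3)

lemma surf_rotational: "rotational_surface (surf \<rho>) 0 (vector [0, 0, 1]) (\<lambda>s. surf \<rho> (s, 0))"
  unfolding rotational_surface_def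
proof (intro conjI exI allI)
  show "norm (vector [0, 0, 1] :: real^3) = 1"
    by (simp add: norm_eq_sqrt_inner inner_vec_def sum_3)
  show "vector [1, 0, 0] \<noteq> (0 :: real^3)" "vector [0, 0, 1] \<bullet> (vector [1, 0, 0] :: real^3) = 0"
    by (simp_all add: inner_vec_def sum_3 vec_eq_iff forall_3)
  fix s \<phi> :: real
  have "surf \<rho> (s, 0) - 0 = height \<rho> s *\<^sub>R vector [0, 0, 1] + radius \<rho> s *\<^sub>R vector [1, 0, 0]"
    by (simp add: surf_def vec_eq_iff forall_3)
  also have "\<dots> \<in> span {vector [0, 0, 1], vector [1, 0, 0]}"
    by (intro span_add span_scale span_base) auto
  finally show "surf \<rho> (s, 0) - 0 \<in> span {vector [0, 0, 1], vector [1, 0, 0]}" .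
  show "surf \<rho> (s, \<phi>) = rotate_about 0 (vector [0, 0, 1]) \<phi> (surf \<rho> (s, 0))"
    by (simp add: surf_def rotate_about_def cross3_def inner_vec_def sum_3 vec_eq_iff forall_3 algebra_simps)
qed

lemma surf_periodic: "periodic_along (vector [0, 0, 1]) (\<lambda>s. surf \<rho> (s, 0))"
  unfolding periodic_along_def
proof (intro exI conjI allI)
  show "period \<rho> \<noteq> 0" using period_pos by simp
  fix k :: int
  let ?\<gamma> = "\<lambda>s. surf \<rho> (s, 0)" and ?\<tau> = "\<lambda>x. x + (of_int k * period \<rho>) *\<^sub>R vector [0, 0, 1]"
  have fwd: "?\<tau> (?\<gamma> s) = ?\<gamma> (s + 2 * pi * of_int (- k))" for s
    unfolding surf_add_2pi_int by simp
  have bwd: "?\<gamma> s = ?\<tau> (?\<gamma> (s + 2 * pi * of_int k))" for s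
    unfolding surf_add_2pi_int by simp
  show "?\<tau> ` range ?\<gamma> = range ?\<gamma>"
  proof
    show "?\<tau> ` range ?\<gamma> \<subseteq> range ?\<gamma>"
      using fwd by blast
    show "range ?\<gamma> \<subseteq> ?\<tau> ` range ?\<gamma>"
      by (rule image_subsetI, subst bwd) (intro imageI rangeI)
  qed
qed

text \<open>
  The radius is symmetric about \<open>pi / 2\<close>, so two parameters \<open>pi / 2 \<plusminus> t\<close> give the same point as soon as
  their heights agree. For \<open>t = pi / 2\<close> the difference of the heights is nonnegative, because the
  height increases while the tangent points upwards, on \<open>[0, pi]\<close>. For \<open>t = pi\<close> it is minus the
  period.
\<close>
lemma surf_self_intersecting: "self_intersecting (surf \<rho>)"
proof -
  define d where "d t = height \<rho> (pi / 2 + t) - height \<rho> (pi / 2 - t)" for t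
  have "d pi = - period \<rho>"
    using height_add_2pi_int[of "- pi / 2" 1] by (simp add: d_def)
  then have "d pi \<le> 0" using period_pos by simp
  moreover have "0 \<le> d (pi / 2)"
  proof -
    have "height \<rho> 0 \<le> height \<rho> pi"
    proof (rule DERIV_nonneg_imp_nondecreasing[where f = "height \<rho>"])
      fix s assume "0 \<le> s" "s \<le> pi"
      then have "0 \<le> speed \<rho> s * sin s"
        using speed_bounds(1)[OF \<rho>, of s] by (simp add: sin_ge_zero)
      with height_deriv[OF \<rho>, of s] show "\<exists>y. (height \<rho> has_real_derivative y) (at s) \<and> 0 \<le> y"
        by blast
    qed simp
    then show ?thesis by (simp add: d_def)
  qed
  moreover have "continuous_on {pi / 2..pi} d"
  proof -
    have "continuous_on UNIV (height \<rho>)"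
      using height_deriv[OF \<rho>] DERIV_isCont by (blast intro: continuous_at_imp_continuous_on)
    note cont = continuous_on_compose2[OF this _ subset_UNIV]
    show ?thesis
      unfolding d_def by (intro continuous_on_diff cont continuous_intros)
  qed
  ultimately obtain t where t: "pi / 2 \<le> t" "t \<le> pi" "d t = 0"
    using IVT2'[of d pi 0 "pi / 2"] by auto
  have "surf \<rho> (pi / 2 + t, 0) = surf \<rho> (pi / 2 - t, 0)"
    using t(3) by (simp add: surf_def d_def radius_def root_fn_def sin_add cos_add sin_diff cos_diff)
  moreover have "\<not> same_point (pi / 2 + t, 0) (pi / 2 - t, 0)"
    using t(1) pi_half_gt_zero by (simp only: same_point_def fst_conv) linarith
  ultimately show ?thesis
    unfolding self_intersecting_def by blast
qed

end

section \<open>Different parameters give non-congruent surfaces\<close>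

lemma orthogonal_isometry_part:
  fixes f :: "'a::euclidean_space \<Rightarrow> 'a"
  assumes "\<And>x y. dist (f x) (f y) = dist x y"
  shows "orthogonal_transformation (\<lambda>x. f x - f 0)"
  unfolding orthogonal_transformation_isometry using assms by (simp add: dist_norm)

text \<open>
  A distance-preserving self-map of a finite-dimensional space is surjective, hence invertible.
\<close>
lemma congruent_sets_sym:
  assumes "congruent_sets A B"
  shows "congruent_sets B A"
proof -
  obtain f where f: "\<And>x y. dist (f x) (f y) = dist x y" "f ` A = B"
    using assms by (auto simp: congruent_sets_def)
  have "surj f"
  proof -
    have "surj (\<lambda>x. f x - f 0)"
      using orthogonal_isometry_part[OF f(1)] by (rule orthogonal_transformation_surj)
    then have "\<exists>x. y = f x" for y
      by (metis (no_types, lifting) add_diff_cancel_right' diff_add_cancel surjD)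
    then show ?thesis by blast
  qed
  then have "dist (inv f x) (inv f y) = dist x y" for x y
    by (metis f(1) surj_f_inv_f)
  moreover have "inj f"
    using f(1) by (metis dist_eq_0_iff injI)
  then have "inv f ` B = A"
    using f(2) by (simp add: inv_f_f image_comp o_def flip: f(2))
  ultimately show ?thesis
    unfolding congruent_sets_def by blast
qed

lemma bounded_affine_imp_slope_0:
  fixes c d :: real
  assumes "\<And>k::nat. \<bar>c + of_nat k * d\<bar> \<le> B"
  shows "d = 0"
proof (rule ccontr)
  assume "d \<noteq> 0"
  then obtain k :: nat where k: "of_nat k * \<bar>d\<bar> > B + \<bar>c\<bar>"
    using ex_less_of_nat_mult[of "\<bar>d\<bar>"] by auto
  have "of_nat k * \<bar>d\<bar> = \<bar>of_nat k * d\<bar>" by (simp add: abs_mult)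
  with k assms[of k] show False by linarith
qed

text \<open>
  The isometry maps an unbounded sequence of equally spaced points on a vertical line of \<open>A\<close> to
  such a sequence on a line parallel to \<open>u\<close>. Since \<open>B\<close> lies in a vertical solid cylinder, \<open>u\<close> is
  vertical. So the linear part of the isometry maps horizontal vectors to horizontal ones, and
  a horizontal diameter of \<open>A\<close> of length \<open>2 r\<close> becomes a horizontal segment of the same length
  inside the cylinder of radius \<open>r'\<close>.
\<close>
lemma congruent_periodic_in_cylinder:
  fixes A B :: "(real^3) set"
  assumes "congruent_sets A B"
    and A: "\<And>k::nat. vector [r, 0, z + of_nat k * T] \<in> A" "vector [- r, 0, z] \<in> A"
    and "T \<noteq> 0" "0 \<le> r"
    and B: "\<And>y. y \<in> B \<Longrightarrow> norm (Complex (y $ 1) (y $ 2)) \<le> r'"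
  shows "r \<le> r'"
proof -
  obtain f where f: "\<And>x y. dist (f x) (f y) = dist x y" "f ` A = B"
    using assms(1) by (auto simp: congruent_sets_def)
  define g where "g x = f x - f 0" for x
  have g: "orthogonal_transformation g"
    unfolding g_def using f(1) by (rule orthogonal_isometry_part)
  then have lin: "linear g" by (rule orthogonal_transformation_linear)
  define u e where "u = g (vector [0, 0, 1])" and "e = g (vector [1, 0, 0])"
  define P where "P = (vector [r, 0, z] :: real^3)"
  have fk: "f (vector [r, 0, z + of_nat k * T]) = f P + (of_nat k * T) *\<^sub>R u" for k :: nat
  proof -
    have "(vector [r, 0, z + of_nat k * T] :: real^3) = P + (of_nat k * T) *\<^sub>R vector [0, 0, 1]"
      by (simp add: P_def vec_eq_iff forall_3)
    then have "g (vector [r, 0, z + of_nat k * T]) = g P + (of_nat k * T) *\<^sub>R u"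
      by (simp add: linear_add[OF lin] linear_cmul[OF lin] u_def)
    then show ?thesis by (simp add: g_def algebra_simps)
  qed
  have hor: "u $ i = 0" if "i = 1 \<or> i = 2" for i
  proof -
    have "\<bar>f P $ i + of_nat k * (T * u $ i)\<bar> \<le> r'" for k :: nat
    proof -
      let ?y = "f P + (of_nat k * T) *\<^sub>R u"
      have "\<bar>?y $ i\<bar> \<le> norm (Complex (?y $ 1) (?y $ 2))"
        using that abs_Re_le_cmod[of "Complex (?y $ 1) (?y $ 2)"] abs_Im_le_cmod[of "Complex (?y $ 1) (?y $ 2)"]
        by auto
      also have "\<dots> \<le> r'"
        using f(2) A(1)[of k] fk[of k] by (intro B) (metis imageI)
      finally show ?thesis by (simp add: mult.assoc)
    qed
    from bounded_affine_imp_slope_0[OF this] show ?thesis using \<open>T \<noteq> 0\<close> by simp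
  qed
  have inner: "g x \<bullet> g y = x \<bullet> y" for x y
    using g by (simp add: orthogonal_transformation_def)
  have "u \<bullet> u = 1" "e \<bullet> u = 0" "e \<bullet> e = 1"
    unfolding u_def e_def inner by (simp_all add: inner_vec_def sum_3)
  then have "e $ 3 = 0"
    using hor by (auto simp: inner_vec_def sum_3)
  then have e: "norm (Complex (e $ 1) (e $ 2)) = 1"
    using \<open>e \<bullet> e = 1\<close> by (simp add: cmod_def inner_vec_def sum_3 power2_eq_square)
  define Q where "Q = (vector [- r, 0, z] :: real^3)"
  have "P - Q = (2 * r) *\<^sub>R vector [1, 0, 0]"
    by (simp add: P_def Q_def vec_eq_iff forall_3)
  then have "f P - f Q = (2 * r) *\<^sub>R e"
    using linear_diff[OF lin, of P Q] linear_cmul[OF lin] by (simp add: e_def) (simp add: g_def)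
  then have "(2 * r) *\<^sub>R Complex (e $ 1) (e $ 2) = Complex (f P $ 1) (f P $ 2) - Complex (f Q $ 1) (f Q $ 2)"
    by (simp add: vec_eq_iff forall_3 complex_eq_iff)
  then have "2 * r = norm (Complex (f P $ 1) (f P $ 2) - Complex (f Q $ 1) (f Q $ 2))"
    using e \<open>0 \<le> r\<close> by (metis abs_of_nonneg mult.right_neutral norm_scaleR zero_le_mult_iff zero_le_numeral)
  also have "\<dots> \<le> r' + r'"
    using f(2) A(1)[of 0] A(2)
    by (intro order_trans[OF norm_triangle_ineq4] add_mono B) (auto simp: P_def Q_def)
  finally show ?thesis by simp
qed

lemma surf_horizontal_norm:
  assumes \<rho>: "2 \<le> \<rho>"
  shows "norm (Complex (surf \<rho> q $ 1) (surf \<rho> q $ 2)) \<le> \<rho> + 1"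
proof -
  define s \<phi> where "s = fst q" and "\<phi> = snd q"
  have "norm (Complex (surf \<rho> q $ 1) (surf \<rho> q $ 2)) = norm (of_real (radius \<rho> s) * cis \<phi>)"
    by (simp add: surf_def s_def \<phi>_def cis.ctr complex_of_real_mult_Complex)
  also have "\<dots> = radius \<rho> s"
    using radius_bounds(1)[OF \<rho>, of s] by (simp add: norm_mult)
  also have "\<dots> \<le> \<rho> + 1"
  proof -
    have "(root_fn \<rho> s)\<^sup>2 \<le> (\<rho> + (1 - sin s))\<^sup>2"
    proof -
      have "(\<rho> + (1 - sin s))\<^sup>2 - (root_fn \<rho> s)\<^sup>2 = (1 - sin s) * (2 * \<rho> - 2 * sin s)"
        unfolding root_fn_square[OF \<rho>] cos_squared_eq by (simp add: power2_eq_square algebra_simps)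
      moreover have "0 \<le> (1 - sin s) * (2 * \<rho> - 2 * sin s)"
        using \<rho> sin_le_one[of s] by (intro mult_nonneg_nonneg) linarith+
      ultimately show ?thesis by linarith
    qed
    then have "root_fn \<rho> s \<le> \<rho> + (1 - sin s)"
      by (rule power2_le_imp_le) (use \<rho> sin_le_one[of s] in linarith)
    then show ?thesis by (simp add: radius_def)
  qed
  finally show ?thesis .
qed

text \<open>
  The maximal distance \<open>\<rho> + 1\<close> from the axis is attained where the tangent angle is
  \<open>pi / 2\<close> modulo \<open>2 * pi\<close>.
\<close>
lemma surf_congruent_imp_le:
  assumes \<rho>: "2 \<le> \<rho>" and \<rho>': "2 \<le> \<rho>'"
    and "congruent_sets (range (surf \<rho>)) (range (surf \<rho>'))"
  shows "\<rho> \<le> \<rho>'"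
proof -
  have rad: "radius \<rho> (pi / 2) = \<rho> + 1"
    using \<rho> by (simp add: radius_def root_fn_def)
  have "vector [\<rho> + 1, 0, height \<rho> (pi / 2) + of_nat k * (- period \<rho>)] \<in> range (surf \<rho>)" for k :: nat
  proof (rule range_eqI)
    show "vector [\<rho> + 1, 0, height \<rho> (pi / 2) + of_nat k * (- period \<rho>)]
        = surf \<rho> (pi / 2 + 2 * pi * of_int (int k), 0)"
      unfolding surf_add_2pi_int[OF \<rho>] by (simp add: surf_def rad vec_eq_iff forall_3)
  qed
  moreover have "vector [- (\<rho> + 1), 0, height \<rho> (pi / 2)] \<in> range (surf \<rho>)"
    by (rule range_eqI[of _ _ "(pi / 2, pi)"]) (simp add: surf_def rad vec_eq_iff forall_3)
  ultimately have "\<rho> + 1 \<le> \<rho>' + 1"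
  proof (rule congruent_periodic_in_cylinder[OF assms(3)])
    show "- period \<rho> \<noteq> 0" using period_pos[OF \<rho>] by simp
  qed (use \<rho> surf_horizontal_norm[OF \<rho>'] in auto)
  then show ?thesis by simp
qed

theorem theorem1p2:
  shows "\<exists>a b c :: real. a\<^sup>2 + 4 * b * c < 0 \<and>
    (\<exists>X :: real \<Rightarrow> real \<times> real \<Rightarrow> real^3.
       (\<forall>t. immersed_cylinder (X t) \<and>
            linear_weingarten a b c (X t) \<and>
            complete_cylinder (X t) \<and>
            self_intersecting (X t) \<and>
            (\<exists>p u \<gamma>. rotational_surface (X t) p u \<gamma> \<and> periodic_along u \<gamma>)) \<and>
       (\<forall>t t'. t \<noteq> t' \<longrightarrow> \<not> congruent_sets (range (X t)) (range (X t'))))"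
proof (intro exI conjI allI impI)
  show "(-2)\<^sup>2 + 4 * 2 * (-1) < (0::real)" by simp
  have \<rho>: "2 \<le> 2 + exp t" for t :: real by simp
  fix t :: real
  show "immersed_cylinder (surf (2 + exp t))" by (rule surf_immersed[OF \<rho>])
  show "linear_weingarten (-2) 2 (-1) (surf (2 + exp t))" by (rule surf_linear_weingarten[OF \<rho>])
  show "complete_cylinder (surf (2 + exp t))" by (rule surf_complete[OF \<rho>])
  show "self_intersecting (surf (2 + exp t))" by (rule surf_self_intersecting[OF \<rho>])
  show "rotational_surface (surf (2 + exp t)) 0 (vector [0, 0, 1]) (\<lambda>s. surf (2 + exp t) (s, 0))"
    by (rule surf_rotational[OF \<rho>])
  show "periodic_along (vector [0, 0, 1]) (\<lambda>s. surf (2 + exp t) (s, 0))"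
    by (rule surf_periodic[OF \<rho>])
  fix t' :: real
  assume "t \<noteq> t'"
  show "\<not> congruent_sets (range (surf (2 + exp t))) (range (surf (2 + exp t')))"
  proof
    assume c: "congruent_sets (range (surf (2 + exp t))) (range (surf (2 + exp t')))"
    have "exp t = exp t'"
      using surf_congruent_imp_le[OF \<rho> \<rho> c] surf_congruent_imp_le[OF \<rho> \<rho> congruent_sets_sym[OF c]]
      by simp
    with \<open>t \<noteq> t'\<close> show False by simp
  qed
qed

end
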